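(* Let $(X,r)$ be a solution and let $n$ be a positive integer. Then $(X,r)$ is $n$-decomposable if and only if its associated biquandle $\mathrm{BQ}(X,r)$ is $n$-decomposable. In particular, $(X,r)$ is decomposable if and only if $\mathrm{BQ}(X,r)$ is decomposable.
   Context: "Solution" means finite bijective non-degenerate set-theoretic solution of the Yang--Baxter equation: a pair $(X,r)$ with $X$ a non-empty finite set and $r:X\times X\to X\times X$, $r(x,y)=(\lambda_x(y),\rho_y(x))$, a bijection such that $(r\times \mathrm{id}_X)(\mathrm{id}_X\times r)(r\times \mathrm{id}_X)=(\mathrm{id}_X\times r)(r\times \mathrm{id}_X)(\mathrm{id}_X\times r)$ and all maps $\lambda_x,\rho_x:X\to X$ are bijective. A subsolution of $(X,r)$ is a non-empty subset $Y\subseteq X$ with $r(Y\times Y)\subseteq Y\times Y$, endowed with the restriction of $r$. $(X,r)$ is $n$-decomposable if there are $n$ subsolutions $(X_1,r_1),\dots,(X_n,r_n)$ such that $\{X_1,\dots,X_n\}$ is a partition of $X$ and $r(X_i\times X_j)=X_j\times X_i$ for all $i,j\in\{1,\dots,n\}$. $(X,r)$ is decomposable if there is a partition $X=Y\cup Z$ with $Y,Z\ne\emptyset$ such that $r(Y\times Y)\subseteq Y\times Y$ and $r(Z\times Z)\subseteq Z\times Z$. The biquandle $\mathrm{BQ}(X,r)$ associated to $(X,r)$ is the solution induced by $r$ on the quotient set $X/\!\sim$, where $\sim$ is the smallest equivalence relation on $X$ such that $x\sim\lambda_x(y)$ whenever $x,y\in X$ satisfy $\rho_y(x)=y$ (it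 is known that $r$ induces a well-defined solution on $X/\!\sim$). *)

theory Defs
  imports Main "HOL-Library.Disjoint_Sets"
begin

text \<open>
  A pair $(X,r)$ is a carrier set together with a function on pairs of the ambient type; only
  the values of \<open>r\<close> on \<open>X \<times> X\<close> matter, so the restriction to a subset of \<open>X\<close> is given by the
  same function.
\<close>

definition lam :: "('a \<times> 'a \<Rightarrow> 'a \<times> 'a) \<Rightarrow> 'a \<Rightarrow> 'a \<Rightarrow> 'a" where
  "lam r x y = fst (r (x, y))"

text \<open>The index of $\rho$ is the second argument of \<open>r\<close>: $r(x,y) = (\lambda_x(y), \rho_y(x))$.\<close>

definition rho :: "('a \<times> 'a \<Rightarrow> 'a \<times> 'a) \<Rightarrow> 'a \<Rightarrow> 'a \<Rightarrow> 'a" where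
  "rho r y x = snd (r (x, y))"

definition r12 :: "('a \<times> 'a \<Rightarrow> 'a \<times> 'a) \<Rightarrow> 'a \<times> 'a \<times> 'a \<Rightarrow> 'a \<times> 'a \<times> 'a" where
  "r12 r = (\<lambda>(x, y, z). (fst (r (x, y)), snd (r (x, y)), z))"

definition r23 :: "('a \<times> 'a \<Rightarrow> 'a \<times> 'a) \<Rightarrow> 'a \<times> 'a \<times> 'a \<Rightarrow> 'a \<times> 'a \<times> 'a" where
  "r23 r = (\<lambda>(x, y, z). (x, r (y, z)))"

definition yang_baxter_on :: "'a set \<Rightarrow> ('a \<times> 'a \<Rightarrow> 'a \<times> 'a) \<Rightarrow> bool" where
  "yang_baxter_on X r \<longleftrightarrow>
     (\<forall>t \<in> X \<times> X \<times> X. (r12 r \<circ> r23 r \<circ> r12 r) t = (r23 r \<circ> r12 r \<circ> r23 r) t)"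

definition solution :: "'a set \<Rightarrow> ('a \<times> 'a \<Rightarrow> 'a \<times> 'a) \<Rightarrow> bool" where
  "solution X r \<longleftrightarrow>
     finite X \<and> X \<noteq> {} \<and>
     bij_betw r (X \<times> X) (X \<times> X) \<and>
     yang_baxter_on X r \<and>
     (\<forall>x\<in>X. bij_betw (lam r x) X X) \<and>
     (\<forall>y\<in>X. bij_betw (rho r y) X X)"

definition subsolution :: "'a set \<Rightarrow> 'a set \<Rightarrow> ('a \<times> 'a \<Rightarrow> 'a \<times> 'a) \<Rightarrow> bool" where
  "subsolution Y X r \<longleftrightarrow> Y \<noteq> {} \<and> Y \<subseteq> X \<and> r ` (Y \<times> Y) \<subseteq> Y \<times> Y"

text \<open>The injectivity of the family makes the partition consist of exactly \<open>n\<close> parts.\<close>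

definition n_decomposable :: "nat \<Rightarrow> 'a set \<Rightarrow> ('a \<times> 'a \<Rightarrow> 'a \<times> 'a) \<Rightarrow> bool" where
  "n_decomposable n X r \<longleftrightarrow>
     (\<exists>P :: nat \<Rightarrow> 'a set.
        (\<forall>i\<in>{1..n}. subsolution (P i) X r) \<and>
        inj_on P {1..n} \<and> partition_on X (P ` {1..n}) \<and>
        (\<forall>i\<in>{1..n}. \<forall>j\<in>{1..n}. r ` (P i \<times> P j) = P j \<times> P i))"

definition decomposable :: "'a set \<Rightarrow> ('a \<times> 'a \<Rightarrow> 'a \<times> 'a) \<Rightarrow> bool" where
  "decomposable X r \<longleftrightarrow>
     (\<exists>Y Z. X = Y \<union> Z \<and> Y \<inter> Z = {} \<and> Y \<noteq> {} \<and> Z \<noteq> {} \<and>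
        r ` (Y \<times> Y) \<subseteq> Y \<times> Y \<and> r ` (Z \<times> Z) \<subseteq> Z \<times> Z)"

definition BQ_rel :: "'a set \<Rightarrow> ('a \<times> 'a \<Rightarrow> 'a \<times> 'a) \<Rightarrow> ('a \<times> 'a) set" where
  "BQ_rel X r =
     \<Inter> {R. equiv X R \<and> (\<forall>x\<in>X. \<forall>y\<in>X. rho r y x = y \<longrightarrow> (x, lam r x y) \<in> R)}"

definition BQ_set :: "'a set \<Rightarrow> ('a \<times> 'a \<Rightarrow> 'a \<times> 'a) \<Rightarrow> 'a set set" where
  "BQ_set X r = X // BQ_rel X r"

text \<open>
  The map induced on classes, $([x],[y]) \mapsto ([\lambda_x(y)], [\rho_y(x)])$. Each union ranges
  over all representatives; for a solution all its members are the same class.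
\<close>

definition BQ_map ::
  "'a set \<Rightarrow> ('a \<times> 'a \<Rightarrow> 'a \<times> 'a) \<Rightarrow> 'a set \<times> 'a set \<Rightarrow> 'a set \<times> 'a set" where
  "BQ_map X r = (\<lambda>(A, B).
     (\<Union>x\<in>A. \<Union>y\<in>B. BQ_rel X r `` {lam r x y},
      \<Union>x\<in>A. \<Union>y\<in>B. BQ_rel X r `` {rho r y x}))"

end

theory Submission imports Defs begin

text \<open>
  An \<open>n\<close>-decomposition is the same thing as a labelling \<open>c\<close> of \<open>X\<close> onto \<open>{1..n}\<close> such that \<open>r\<close>
  swaps labels: if \<open>r (x, y) = (u, v)\<close>, then \<open>c u = c y\<close> and \<open>c v = c x\<close>
  (lemma \<open>n_decomposable_iff_labelling\<close>; the parts are the fibres of \<open>c\<close>). In this form the theorem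
  is nearly immediate. The relation \<open>BQ_rel\<close> is generated by the pairs \<open>(a, z)\<close> with
  \<open>r (a, y) = (z, y)\<close> for some \<open>y\<close>. A label-swapping \<open>c\<close> satisfies \<open>c z = c y = c a\<close> there,
  so it is constant on classes and descends to the biquandle; conversely a labelling of the biquandle
  is pulled back along the projection.

  Both transfers require the projection \<open>x \<mapsto> [x]\<close> to be a homomorphism from \<open>r\<close> to \<open>BQ_map\<close>, that is,
  \<open>BQ_rel\<close> must be a congruence (lemmas \<open>BQ_rel_congruence\<close> and \<open>BQ_map_class\<close>). It
  suffices to look at a generating pair \<open>(a, z)\<close>. The Yang--Baxter equation on triples containing
  \<open>a, y\<close> gives that \<open>a\<close> and \<open>z\<close> act in the same way,
  \<open>\<lambda>\<^sub>a = \<lambda>\<^sub>z\<close> and \<open>\<rho>\<^sub>a = \<rho>\<^sub>z\<close>, and that every \<open>\<lambda>\<^sub>w\<close> and \<open>\<rho>\<^sub>w\<close> maps \<open>(a, z)\<close>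
  to another generating pair.

  For the second part, finiteness makes every \<open>\<lambda>\<^sub>y\<close> and \<open>\<rho>\<^sub>y\<close> with \<open>y\<close> in a block \<open>Y\<close> permute
  \<open>Y\<close>, hence also its complement, so a two-block decomposition swaps labels automatically
  and decomposability of \<open>X\<close> is 2-decomposability. One therefore goes from \<open>X\<close> to the biquandle by
  the first part with \<open>n = 2\<close>, and back by taking preimages of the two blocks.
\<close>

section \<open>Decompositions as labellings\<close>

definition swaps_labels :: "'a set \<Rightarrow> ('a \<times> 'a \<Rightarrow> 'a \<times> 'a) \<Rightarrow> ('a \<Rightarrow> nat) \<Rightarrow> bool" where
  "swaps_labels X r c \<longleftrightarrow> (\<forall>x\<in>X. \<forall>y\<in>X. c (lam r x y) = c y \<and> c (rho r y x) = c x)"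

lemma r_eq: "r (x, y) = (lam r x y, rho r y x)"
  by (simp add: lam_def rho_def)

text \<open>
  Surjectivity of \<open>r\<close> is what turns the inclusions \<open>r ` (P i \<times> P j) \<subseteq> P j \<times> P i\<close>, all that
  label-swapping says directly, into equalities.
\<close>

lemma n_decomposable_iff_labelling:
  assumes surj: "r ` (X \<times> X) = X \<times> X"
  shows "n_decomposable n X r \<longleftrightarrow> (\<exists>c. c ` X = {1..n} \<and> swaps_labels X r c)"
proof
  assume "n_decomposable n X r"
  then obtain P :: "nat \<Rightarrow> 'a set" where
    sub: "\<forall>i\<in>{1..n}. subsolution (P i) X r" and
    inj: "inj_on P {1..n}" and part: "partition_on X (P ` {1..n})" and
    swap': "\<forall>i\<in>{1..n}. \<forall>j\<in>{1..n}. r ` (P i \<times> P j) = P j \<times> P i"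
    unfolding n_decomposable_def by (elim exE conjE)
  have ne: "P i \<noteq> {}" if "i \<in> {1..n}" for i
    using sub that unfolding subsolution_def by blast
  have swap: "r ` (P i \<times> P j) = P j \<times> P i" if "i \<in> {1..n}" "j \<in> {1..n}" for i j
    by (rule swap'[THEN bspec, THEN bspec, OF that])
  have X: "X = (\<Union>i\<in>{1..n}. P i)"
    by (rule partition_onD1[OF part])
  have disj: "i = j" if "i \<in> {1..n}" "j \<in> {1..n}" "x \<in> P i" "x \<in> P j" for i j x
  proof (rule inj_onD[OF inj _ that(1,2)])
    show "P i = P j"
      using disjointD[OF partition_onD2[OF part], of "P i" "P j"] that by auto
  qed
  have "\<forall>x\<in>X. \<exists>i. i \<in> {1..n} \<and> x \<in> P i"
    using X by blast
  then obtain c where c: "\<And>x. x \<in> X \<Longrightarrow> c x \<in> {1..n} \<and> x \<in> P (c x)"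
    by metis
  have c_unique: "c x = i" if "i \<in> {1..n}" "x \<in> P i" for i x
    by (rule disj[of _ _ x]) (use that c X in blast)+
  have "c ` X = {1..n}"
  proof
    show "c ` X \<subseteq> {1..n}" using c by blast
    show "{1..n} \<subseteq> c ` X"
    proof
      fix i assume i: "i \<in> {1..n}"
      then obtain x where "x \<in> P i" using ne by blast
      then show "i \<in> c ` X" using i c_unique X by blast
    qed
  qed
  moreover have "c (lam r x y) = c y \<and> c (rho r y x) = c x" if "x \<in> X" "y \<in> X" for x y
  proof -
    have "r (x, y) \<in> P (c y) \<times> P (c x)"
      using swap[of "c x" "c y"] c that by blast
    then have "lam r x y \<in> P (c y)" "rho r y x \<in> P (c x)" by (simp_all add: r_eq[of r])
    then show ?thesis using c_unique c[OF that(1)] c[OF that(2)] by blast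
  qed
  ultimately show "\<exists>c. c ` X = {1..n} \<and> swaps_labels X r c"
    unfolding swaps_labels_def by (intro exI[of _ c]) simp
next
  assume "\<exists>c. c ` X = {1..n} \<and> swaps_labels X r c"
  then obtain c where im: "c ` X = {1..n}" and c: "swaps_labels X r c" by blast
  define P where "P i = {x \<in> X. c x = i}" for i
  have ne: "P i \<noteq> {}" if "i \<in> {1..n}" for i
    using that im unfolding P_def by (metis (mono_tags, lifting) empty_iff imageE mem_Collect_eq)
  have swap: "r ` (P i \<times> P j) = P j \<times> P i" for i j
  proof
    show "r ` (P i \<times> P j) \<subseteq> P j \<times> P i"
    proof
      fix p assume "p \<in> r ` (P i \<times> P j)"
      then obtain x y where xy: "p = r (x, y)" "x \<in> P i" "y \<in> P j" by blast
      then have "p \<in> X \<times> X" using surj unfolding P_def by blast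
      then show "p \<in> P j \<times> P i"
        using xy c by (simp add: P_def swaps_labels_def r_eq[of r])
    qed
    show "P j \<times> P i \<subseteq> r ` (P i \<times> P j)"
    proof
      fix p assume p: "p \<in> P j \<times> P i"
      then have "p \<in> X \<times> X" unfolding P_def by blast
      then obtain x y where xy: "p = r (x, y)" "x \<in> X" "y \<in> X" using surj by blast
      then have "x \<in> P i" "y \<in> P j"
        using p c by (simp_all add: P_def swaps_labels_def r_eq[of r])
      then show "p \<in> r ` (P i \<times> P j)" using xy by blast
    qed
  qed
  have "inj_on P {1..n}"
  proof (rule inj_onI)
    fix i j assume "i \<in> {1..n}" "P i = P j"
    then show "i = j" using ne[of i] unfolding P_def by blast
  qed
  moreover have "partition_on X (P ` {1..n})"
  proof (rule partition_onI)
    show "\<Union> (P ` {1..n}) = X" using im unfolding P_def by blast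
  next
    fix A B assume "A \<in> P ` {1..n}" "B \<in> P ` {1..n}" "A \<noteq> B"
    then show "disjnt A B" by (auto simp: P_def disjnt_def)
  next
    show "{} \<notin> P ` {1..n}" using ne by blast
  qed
  moreover have "subsolution (P i) X r" if "i \<in> {1..n}" for i
    using ne[OF that] swap[of i i] unfolding subsolution_def by (auto simp: P_def)
  ultimately show "n_decomposable n X r"
    unfolding n_decomposable_def by (intro exI[of _ P] conjI ballI swap) simp_all
qed

lemma decomposable_if_2_decomposable:
  assumes "n_decomposable 2 X r"
  shows "decomposable X r"
proof -
  have two: "{1..2::nat} = {1, 2}" by auto
  obtain P :: "nat \<Rightarrow> 'a set" where
    sub_all: "\<forall>i\<in>{1..2}. subsolution (P i) X r" and
    inj: "inj_on P {1..2}" and part_im: "partition_on X (P ` {1..2})"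
    using assms unfolding n_decomposable_def by (elim exE conjE)
  have sub: "subsolution (P 1) X r" "subsolution (P 2) X r"
    using sub_all by simp_all
  have part: "partition_on X {P 1, P 2}"
    using part_im unfolding two by simp
  have "P 1 \<noteq> P 2" using inj unfolding two by simp
  then have "P 1 \<inter> P 2 = {}" using partition_onD2[OF part] unfolding disjoint_def by simp
  moreover have "\<Union> {P 1, P 2} = P 1 \<union> P 2" by simp
  then have "X = P 1 \<union> P 2" unfolding partition_onD1[OF part, symmetric] .
  ultimately show ?thesis
    using sub unfolding decomposable_def subsolution_def
    by (intro exI[of _ "P 1"] exI[of _ "P 2"] conjI) (elim conjE, assumption)+
qed

section \<open>Solutions in components\<close>

context
  fixes X :: "'a set" and r :: "'a \<times> 'a \<Rightarrow> 'a \<times> 'a"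
  assumes sol: "solution X r"
begin

lemma r_surj: "r ` (X \<times> X) = X \<times> X"
  using sol unfolding solution_def bij_betw_def by blast

lemma lam_in: "x \<in> X \<Longrightarrow> y \<in> X \<Longrightarrow> lam r x y \<in> X"
  and rho_in: "x \<in> X \<Longrightarrow> y \<in> X \<Longrightarrow> rho r y x \<in> X"
  using sol unfolding solution_def bij_betw_def by blast+

lemma lam_inj: "x \<in> X \<Longrightarrow> inj_on (lam r x) X"
  and lam_surj: "x \<in> X \<Longrightarrow> lam r x ` X = X"
  and rho_inj: "x \<in> X \<Longrightarrow> inj_on (rho r x) X"
  using sol unfolding solution_def bij_betw_def by blast+

lemma yang_baxter_components:
  assumes "x \<in> X" "y \<in> X" "z \<in> X"
  shows yb1: "lam r (lam r x y) (lam r (rho r y x) z) = lam r x (lam r y z)"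
    and yb2: "rho r (lam r (rho r y x) z) (lam r x y) = lam r (rho r (lam r y z) x) (rho r z y)"
    and yb3: "rho r z (rho r y x) = rho r (rho r z y) (rho r (lam r y z) x)"
proof -
  have "(r12 r \<circ> r23 r \<circ> r12 r) (x, y, z) = (r23 r \<circ> r12 r \<circ> r23 r) (x, y, z)"
    using sol assms unfolding solution_def yang_baxter_on_def by blast
  then show "lam r (lam r x y) (lam r (rho r y x) z) = lam r x (lam r y z)"
    and "rho r (lam r (rho r y x) z) (lam r x y) = lam r (rho r (lam r y z) x) (rho r z y)"
    and "rho r z (rho r y x) = rho r (rho r z y) (rho r (lam r y z) x)"
    by (simp_all add: r12_def r23_def r_eq[of r])
qed

text \<open>
  The block \<open>Y\<close> is finite and \<open>f\<close> is injective, so \<open>f\<close> permutes \<open>Y\<close> and leaves no room in \<open>Y\<close>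
  for images of other points.
\<close>

lemma inj_preserves_complement:
  assumes "inj_on f X" "f ` X \<subseteq> X" "f ` Y \<subseteq> Y" "Y \<subseteq> X" "x \<in> X"
  shows "f x \<in> Y \<longleftrightarrow> x \<in> Y"
proof -
  have "finite Y" using sol assms(4) unfolding solution_def by (auto intro: finite_subset)
  then have "f ` Y = Y"
    using endo_inj_surj[of Y f] assms by (meson inj_on_subset)
  then show ?thesis
    using inj_on_image_mem_iff[OF assms(1,5,4)] by simp
qed

lemma closed_block_action:
  assumes closed: "r ` (W \<times> W) \<subseteq> W \<times> W" and W: "W \<subseteq> X" and x: "x \<in> W" and y: "y \<in> X"
  shows "lam r x y \<in> W \<longleftrightarrow> y \<in> W" and "rho r x y \<in> W \<longleftrightarrow> y \<in> W"
proof -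
  have xX: "x \<in> X" using W x by (rule subsetD)
  have r_in: "r (u, v) \<in> W \<times> W" if "u \<in> W" "v \<in> W" for u v
    using closed that by blast
  have "lam r x ` W \<subseteq> W"
    using r_in[OF x] unfolding lam_def mem_Times_iff by blast
  then show "lam r x y \<in> W \<longleftrightarrow> y \<in> W"
    using lam_in[OF xX] by (intro inj_preserves_complement lam_inj xX W y) auto
  have "rho r x ` W \<subseteq> W"
    using r_in[OF _ x] unfolding rho_def mem_Times_iff by blast
  then show "rho r x y \<in> W \<longleftrightarrow> y \<in> W"
    using rho_in[OF _ xX] by (intro inj_preserves_complement rho_inj xX W y) auto
qed

lemma decomposable_iff_2_decomposable: "decomposable X r \<longleftrightarrow> n_decomposable 2 X r"
proof
  assume "decomposable X r"
  then obtain Y Z where X: "X = Y \<union> Z" "Y \<inter> Z = {}" and ne: "Y \<noteq> {}" "Z \<noteq> {}"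
    and Y: "r ` (Y \<times> Y) \<subseteq> Y \<times> Y" and Z: "r ` (Z \<times> Z) \<subseteq> Z \<times> Z"
    unfolding decomposable_def by blast
  define c where "c x = (if x \<in> Y then 1 else 2 :: nat)" for x
  have keeps: "(lam r x y \<in> Y \<longleftrightarrow> y \<in> Y) \<and> (rho r x y \<in> Y \<longleftrightarrow> y \<in> Y)"
    if xy: "x \<in> X" "y \<in> X" for x y
  proof (cases "x \<in> Y")
    case True
    then show ?thesis using closed_block_action[OF Y _ True xy(2)] X(1) by simp
  next
    case False
    then have x: "x \<in> Z" using X(1) xy(1) by simp
    have "(lam r x y \<in> Z \<longleftrightarrow> y \<in> Z) \<and> (rho r x y \<in> Z \<longleftrightarrow> y \<in> Z)"
      using closed_block_action[OF Z _ x xy(2)] X(1) by simp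
    moreover have "u \<in> Z \<longleftrightarrow> u \<notin> Y" if "u \<in> X" for u
      using that X by auto
    ultimately show ?thesis
      using xy(2) lam_in[OF xy] rho_in[OF xy(2,1)] by simp
  qed
  have "swaps_labels X r c"
    unfolding swaps_labels_def c_def using keeps by simp
  moreover have "c ` X = {1..2}"
  proof -
    have "c ` Y = {1}" "c ` Z = {2}"
      using ne X unfolding c_def by auto
    then show ?thesis unfolding X image_Un by auto
  qed
  ultimately show "n_decomposable 2 X r"
    by (intro n_decomposable_iff_labelling[OF r_surj, THEN iffD2] exI[of _ c] conjI)
qed (rule decomposable_if_2_decomposable)

section \<open>The biquandle relation is a congruence\<close>

lemma equiv_BQ_rel: "equiv X (BQ_rel X r)"
proof (rule equivI)
  \<comment> \<open>The intersection is over a nonempty family: the full relation satisfies all requirements.\<close>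
  have "equiv X (X \<times> X)"
    by (auto simp: equiv_def refl_on_def sym_def trans_def)
  then show "BQ_rel X r \<subseteq> X \<times> X"
    unfolding BQ_rel_def using lam_in by blast
  show "refl_on X (BQ_rel X r)"
    unfolding BQ_rel_def by (auto simp: refl_on_def equiv_def)
  show "sym (BQ_rel X r)"
    unfolding BQ_rel_def by (auto simp: sym_def equiv_def)
  show "trans (BQ_rel X r)"
    unfolding BQ_rel_def equiv_def by (auto intro!: transI dest: transD)
qed

lemma BQ_rel_generator:
  "x \<in> X \<Longrightarrow> y \<in> X \<Longrightarrow> rho r y x = y \<Longrightarrow> (x, lam r x y) \<in> BQ_rel X r"
  unfolding BQ_rel_def by blast

lemma BQ_rel_least:
  assumes "equiv X R"
    and "\<And>x y. x \<in> X \<Longrightarrow> y \<in> X \<Longrightarrow> rho r y x = y \<Longrightarrow> (x, lam r x y) \<in> R"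
  shows "BQ_rel X r \<subseteq> R"
  unfolding BQ_rel_def using assms by blast

text \<open>
  For \<open>\<lambda>\<close> the Yang--Baxter equation gives \<open>\<lambda>\<^sub>a \<lambda>\<^sub>y = \<lambda>\<^sub>z \<lambda>\<^sub>y\<close> with \<open>z = \<lambda>\<^sub>a(y)\<close>, and
  \<open>\<lambda>\<^sub>y\<close> cancels as a surjection; for \<open>\<rho>\<close> it gives \<open>\<rho>\<^sub>y \<rho>\<^sub>a = \<rho>\<^sub>y \<rho>\<^sub>z\<close>, and \<open>\<rho>\<^sub>y\<close>
  cancels as an injection.
\<close>

lemma generator_same_action:
  assumes a: "a \<in> X" and y: "y \<in> X" and fix_y: "rho r y a = y" and w: "w \<in> X"
  shows "lam r (lam r a y) w = lam r a w" and "rho r (lam r a y) w = rho r a w"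
proof -
  obtain v where "v \<in> X" "w = lam r y v" using lam_surj[OF y] w by blast
  then show "lam r (lam r a y) w = lam r a w" using yb1[OF a y] fix_y by simp
  have "rho r y (rho r a w) = rho r y (rho r (lam r a y) w)"
    using yb3[OF w a y] fix_y by simp
  then show "rho r (lam r a y) w = rho r a w"
    using rho_inj[OF y] a y w by (metis inj_onD lam_in rho_in)
qed

text \<open>
  The new witnesses replacing \<open>y\<close> are the strands that the Yang--Baxter move makes out of it:
  \<open>\<lambda>\<close> of \<open>\<rho>\<^sub>a(w)\<close> applied to \<open>y\<close> when \<open>w\<close> starts on the left of \<open>a, y\<close>, and
  \<open>\<rho>\<^sub>v(y)\<close> when a strand \<open>v\<close> with \<open>\<lambda>\<^sub>y(v) = w\<close> starts on their right.
\<close>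

lemma generator_image:
  assumes a: "a \<in> X" and y: "y \<in> X" and fix_y: "rho r y a = y" and w: "w \<in> X"
  shows "(lam r w a, lam r w (lam r a y)) \<in> BQ_rel X r"
    and "(rho r w a, rho r w (lam r a y)) \<in> BQ_rel X r"
proof -
  let ?y' = "lam r (rho r a w) y"
  have "rho r ?y' (lam r w a) = ?y'"
    using yb2[OF w a y] fix_y generator_same_action(2)[OF a y fix_y w] by simp
  moreover have "lam r (lam r w a) ?y' = lam r w (lam r a y)"
    using yb1[OF w a y] by simp
  ultimately show "(lam r w a, lam r w (lam r a y)) \<in> BQ_rel X r"
    using BQ_rel_generator[of "lam r w a" ?y'] a w y by (simp add: lam_in rho_in)
next
  obtain v where v: "v \<in> X" "w = lam r y v" using lam_surj[OF y] w by blast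
  have "rho r (rho r v y) (rho r w a) = rho r v y"
    using yb3[OF a y v(1)] fix_y v(2) by simp
  moreover have "lam r (rho r w a) (rho r v y) = rho r w (lam r a y)"
    using yb2[OF a y v(1)] fix_y v(2) by simp
  ultimately show "(rho r w a, rho r w (lam r a y)) \<in> BQ_rel X r"
    using BQ_rel_generator[of "rho r w a" "rho r v y"] a w y v(1) by (simp add: rho_in)
qed

lemma BQ_rel_congruence:
  assumes "(a, b) \<in> BQ_rel X r" and "w \<in> X"
  shows "lam r a w = lam r b w" and "rho r a w = rho r b w"
    and "(lam r w a, lam r w b) \<in> BQ_rel X r" and "(rho r w a, rho r w b) \<in> BQ_rel X r"
proof -
  let ?E = "BQ_rel X r"
  have refl: "(x, x) \<in> ?E" if "x \<in> X" for x
    using equiv_BQ_rel that by (simp add: equiv_def refl_on_def)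
  have sym: "(x, y) \<in> ?E \<Longrightarrow> (y, x) \<in> ?E" for x y
    using equiv_BQ_rel by (meson equivE symD)
  have trans: "(x, y) \<in> ?E \<Longrightarrow> (y, z) \<in> ?E \<Longrightarrow> (x, z) \<in> ?E" for x y z
    using equiv_BQ_rel by (meson equivE transD)
  \<comment> \<open>The desired conclusion itself, as a relation: it is an equivalence that contains the
      generators, hence contains the least such one.\<close>
  define C where "C = {(a, b) \<in> X \<times> X. \<forall>w\<in>X. lam r a w = lam r b w \<and> rho r a w = rho r b w \<and>
    (lam r w a, lam r w b) \<in> ?E \<and> (rho r w a, rho r w b) \<in> ?E}"
  have "equiv X C"
  proof (rule equivI)
    show "C \<subseteq> X \<times> X" unfolding C_def by blast
    show "refl_on X C"
      unfolding C_def by (auto simp: refl_on_def lam_in rho_in intro!: refl)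
    show "Relation.sym C"
      by (rule symI) (auto simp: C_def intro: sym)
    show "Relation.trans C"
      by (rule transI) (auto simp: C_def intro: trans)
  qed
  then have "?E \<subseteq> C"
  proof (rule BQ_rel_least)
    fix x y assume "x \<in> X" "y \<in> X" "rho r y x = y"
    then show "(x, lam r x y) \<in> C"
      unfolding C_def using generator_same_action[of x y] generator_image[of x y]
      by (simp add: lam_in)
  qed
  then show "lam r a w = lam r b w" and "rho r a w = rho r b w"
    and "(lam r w a, lam r w b) \<in> ?E" and "(rho r w a, rho r w b) \<in> ?E"
    using assms unfolding C_def by blast+
qed

section \<open>Projection onto the biquandle\<close>

abbreviation bq_class :: "'a \<Rightarrow> 'a set" where
  "bq_class x \<equiv> BQ_rel X r `` {x}"

lemma BQ_set_eq_image: "BQ_set X r = bq_class ` X"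
  by (auto simp: BQ_set_def quotient_def)

lemma bq_class_eq: "(x, y) \<in> BQ_rel X r \<Longrightarrow> bq_class x = bq_class y"
  using equiv_BQ_rel by (rule equiv_class_eq)

lemma BQ_map_class:
  assumes x: "x \<in> X" and y: "y \<in> X"
  shows "BQ_map X r (bq_class x, bq_class y) = (bq_class (lam r x y), bq_class (rho r y x))"
proof -
  have in_X: "a \<in> X" if "(b, a) \<in> BQ_rel X r" for a b
    using equiv_BQ_rel that by (auto simp: equiv_def)
  have self: "x \<in> bq_class x" "y \<in> bq_class y"
    using equiv_class_self[OF equiv_BQ_rel] x y by auto
  have const: "bq_class (lam r a b) = bq_class (lam r x y) \<and>
      bq_class (rho r b a) = bq_class (rho r y x)"
    if a: "a \<in> bq_class x" and b: "b \<in> bq_class y" for a b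
  proof -
    have a': "(x, a) \<in> BQ_rel X r" and b': "(y, b) \<in> BQ_rel X r" using a b by auto
    have "bq_class (lam r x y) = bq_class (lam r x b)"
      by (rule bq_class_eq, rule BQ_rel_congruence(3)[OF b' x])
    moreover have "lam r x b = lam r a b"
      by (rule BQ_rel_congruence(1)[OF a' in_X[OF b']])
    moreover have "bq_class (rho r y x) = bq_class (rho r y a)"
      by (rule bq_class_eq, rule BQ_rel_congruence(4)[OF a' y])
    moreover have "rho r y a = rho r b a"
      by (rule BQ_rel_congruence(2)[OF b' in_X[OF a']])
    ultimately show ?thesis by simp
  qed
  have "(\<Union>a\<in>bq_class x. \<Union>b\<in>bq_class y. bq_class (lam r a b)) = bq_class (lam r x y)"
    using const self by blast
  moreover have "(\<Union>a\<in>bq_class x. \<Union>b\<in>bq_class y. bq_class (rho r b a)) = bq_class (rho r y x)"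
    using const self by blast
  ultimately show ?thesis by (simp add: BQ_map_def)
qed

lemma BQ_components:
  assumes "x \<in> X" "y \<in> X"
  shows "lam (BQ_map X r) (bq_class x) (bq_class y) = bq_class (lam r x y)"
    and "rho (BQ_map X r) (bq_class y) (bq_class x) = bq_class (rho r y x)"
  using BQ_map_class[OF assms] by (simp_all add: lam_def rho_def)

lemma BQ_map_surj: "BQ_map X r ` (BQ_set X r \<times> BQ_set X r) = BQ_set X r \<times> BQ_set X r"
proof
  show "BQ_map X r ` (BQ_set X r \<times> BQ_set X r) \<subseteq> BQ_set X r \<times> BQ_set X r"
    unfolding BQ_set_eq_image using BQ_map_class lam_in rho_in by auto
  show "BQ_set X r \<times> BQ_set X r \<subseteq> BQ_map X r ` (BQ_set X r \<times> BQ_set X r)"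
  proof
    fix p assume "p \<in> BQ_set X r \<times> BQ_set X r"
    then obtain u v where p: "p = (bq_class u, bq_class v)" "u \<in> X" "v \<in> X"
      unfolding BQ_set_eq_image by blast
    then have "(u, v) \<in> r ` (X \<times> X)" using r_surj by blast
    then obtain x y where xy: "x \<in> X" "y \<in> X" "lam r x y = u" "rho r y x = v"
      by (auto simp: r_eq[of r])
    then have "p = BQ_map X r (bq_class x, bq_class y)"
      using BQ_map_class p by simp
    then show "p \<in> BQ_map X r ` (BQ_set X r \<times> BQ_set X r)"
      using xy unfolding BQ_set_eq_image by blast
  qed
qed

text \<open>
  For \<open>r (x, y) = (z, y)\<close> the first entry carries the label of \<open>y\<close> and the second, again
  \<open>y\<close>, that of \<open>x\<close>; so \<open>x\<close>, \<open>y\<close> and \<open>z\<close> have one common label.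
\<close>

lemma labelling_constant_on_classes:
  assumes c: "swaps_labels X r c" and ab: "(a, b) \<in> BQ_rel X r"
  shows "c a = c b"
proof -
  have "equiv X {(a, b) \<in> X \<times> X. c a = c b}"
    by (auto simp: equiv_def refl_on_def sym_def trans_def)
  then have "BQ_rel X r \<subseteq> {(a, b) \<in> X \<times> X. c a = c b}"
    by (rule BQ_rel_least) (use c lam_in in \<open>auto simp: swaps_labels_def\<close>, metis)
  then show ?thesis using ab by blast
qed

lemma swaps_labels_BQ_iff:
  "swaps_labels (BQ_set X r) (BQ_map X r) d \<longleftrightarrow> swaps_labels X r (d \<circ> bq_class)"
  unfolding swaps_labels_def BQ_set_eq_image by (simp add: BQ_components)

lemma n_decomposable_iff_BQ:
  "n_decomposable n X r \<longleftrightarrow> n_decomposable n (BQ_set X r) (BQ_map X r)"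
proof -
  have "(\<exists>c. c ` X = {1..n} \<and> swaps_labels X r c) \<longleftrightarrow>
    (\<exists>d. d ` BQ_set X r = {1..n} \<and> swaps_labels (BQ_set X r) (BQ_map X r) d)"
  proof
    assume "\<exists>c. c ` X = {1..n} \<and> swaps_labels X r c"
    then obtain c where im: "c ` X = {1..n}" and c: "swaps_labels X r c" by blast
    define d where "d A = c (SOME a. a \<in> A)" for A
    have d: "d (bq_class x) = c x" if "x \<in> X" for x
    proof -
      have "x \<in> bq_class x" using equiv_class_self[OF equiv_BQ_rel that] .
      then have "(SOME a. a \<in> bq_class x) \<in> bq_class x" by (rule someI)
      then show ?thesis
        unfolding d_def using labelling_constant_on_classes[OF c] by simp
    qed
    have "d ` BQ_set X r = c ` X"
      unfolding BQ_set_eq_image image_image using d by (rule image_cong[OF refl])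
    moreover have "swaps_labels X r (d \<circ> bq_class)"
      using c unfolding swaps_labels_def by (simp add: d lam_in rho_in)
    ultimately show "\<exists>d. d ` BQ_set X r = {1..n} \<and> swaps_labels (BQ_set X r) (BQ_map X r) d"
      by (intro exI[of _ d]) (simp add: im swaps_labels_BQ_iff)
  next
    assume "\<exists>d. d ` BQ_set X r = {1..n} \<and> swaps_labels (BQ_set X r) (BQ_map X r) d"
    then obtain d where "d ` BQ_set X r = {1..n}" "swaps_labels (BQ_set X r) (BQ_map X r) d"
      by blast
    then have "(d \<circ> bq_class) ` X = {1..n}" "swaps_labels X r (d \<circ> bq_class)"
      unfolding swaps_labels_BQ_iff by (simp_all only: BQ_set_eq_image image_comp)
    then show "\<exists>c. c ` X = {1..n} \<and> swaps_labels X r c" by blast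
  qed
  then show ?thesis
    by (simp only: n_decomposable_iff_labelling[OF r_surj]
        n_decomposable_iff_labelling[OF BQ_map_surj])
qed

text \<open>
  The preimage of a block of the biquandle is closed under \<open>r\<close> because the projection is a
  homomorphism.
\<close>

lemma decomposable_if_BQ_decomposable:
  assumes "decomposable (BQ_set X r) (BQ_map X r)"
  shows "decomposable X r"
proof -
  obtain Y Z where BQ: "BQ_set X r = Y \<union> Z" "Y \<inter> Z = {}" and ne: "Y \<noteq> {}" "Z \<noteq> {}"
    and Y: "BQ_map X r ` (Y \<times> Y) \<subseteq> Y \<times> Y" and Z: "BQ_map X r ` (Z \<times> Z) \<subseteq> Z \<times> Z"
    using assms unfolding decomposable_def by blast
  define pre where "pre W = {x \<in> X. bq_class x \<in> W}" for W
  have closed: "r ` (pre W \<times> pre W) \<subseteq> pre W \<times> pre W"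
    if W: "BQ_map X r ` (W \<times> W) \<subseteq> W \<times> W" for W
  proof
    fix p assume "p \<in> r ` (pre W \<times> pre W)"
    then obtain x y where p: "p = r (x, y)" and xy: "x \<in> X" "y \<in> X"
      and cl: "bq_class x \<in> W" "bq_class y \<in> W"
      unfolding pre_def by blast
    have "BQ_map X r (bq_class x, bq_class y) \<in> W \<times> W" using W cl by blast
    then show "p \<in> pre W \<times> pre W"
      unfolding pre_def p r_eq[of r] BQ_map_class[OF xy] using xy by (simp add: lam_in rho_in)
  qed
  have class_in: "bq_class x \<in> Y \<union> Z" if "x \<in> X" for x
    using that unfolding BQ(1)[symmetric] BQ_set_eq_image by auto
  have lift: "\<exists>x\<in>X. bq_class x = A" if "A \<in> Y \<union> Z" for A
    using that unfolding BQ(1)[symmetric] BQ_set_eq_image by auto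
  have "X = pre Y \<union> pre Z" using class_in unfolding pre_def by auto
  moreover have "pre Y \<inter> pre Z = {}" using BQ(2) unfolding pre_def by blast
  moreover have "pre Y \<noteq> {}" "pre Z \<noteq> {}"
    using lift ne unfolding pre_def by blast+
  ultimately show ?thesis
    unfolding decomposable_def using closed[OF Y] closed[OF Z] by blast
qed

lemma decomposable_iff_BQ: "decomposable X r \<longleftrightarrow> decomposable (BQ_set X r) (BQ_map X r)"
  using decomposable_iff_2_decomposable n_decomposable_iff_BQ decomposable_if_2_decomposable
    decomposable_if_BQ_decomposable by blast

end

theorem theorem3p12:
  fixes X :: "'a set" and r :: "'a \<times> 'a \<Rightarrow> 'a \<times> 'a" and n :: nat
  assumes "solution X r" and "n \<ge> 1"
  shows "(n_decomposable n X r \<longleftrightarrow> n_decomposable n (BQ_set X r) (BQ_map X r)) \<and>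
         (decomposable X r \<longleftrightarrow> decomposable (BQ_set X r) (BQ_map X r))"
  using n_decomposable_iff_BQ[OF assms(1)] decomposable_iff_BQ[OF assms(1)] by blast

end
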